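(* Let $\mathcal{X}=\mathbf{R}$ and let $\mu$ be the Lebesgue measure on $\mathbf{R}$. There exist absolute constants $C_0,C_1,C_2,C_3>0$ such that the following holds. Let $L>0$. For any integer $n\ge1$, there exist a probability density $f$ with respect to $\mu$ bounded by $L$ and a dictionary $\{f_1,\ldots,f_M\}$ of functions bounded by $2L$, with $C_0\sqrt n\le M\le C_1\sqrt n$, such that, given $n$ i.i.d. observations $X_1,\ldots,X_n$ with density $f$, with probability greater than $1-12\exp(-C_2M)$, $$\|f_{\hat\theta^{\mathrm{ERM}}}-f\|^2\ \ge\ \min_{j=1,\ldots,M}\|f_j-f\|^2+\frac{C_3L}{\sqrt n},$$ where $\hat\theta^{\mathrm{ERM}}:=\operatorname{argmin}_{\theta\in\Lambda^M}R_n(f_\theta)$.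
   Context: $\|\cdot\|$ is the $L^2(\mu)$ norm. $\Lambda^M=\{\theta\in\mathbf{R}^M:\ \theta_j\ge0\ \forall j,\ \sum_{j=1}^M\theta_j=1\}$ is the simplex, and for $\theta\in\Lambda^M$, $f_\theta=\sum_{j=1}^M\theta_jf_j$. The empirical risk of $g\in L^2(\mu)$ is $R_n(g)=\|g\|^2-\frac2n\sum_{i=1}^n g(X_i)$. A dictionary is a finite set of deterministic functions in $L^2(\mu)$. *)

theory Defs
  imports "HOL-Probability.Probability"
begin

definition square_integrable :: "'a measure \<Rightarrow> ('a \<Rightarrow> real) \<Rightarrow> bool" where
  "square_integrable \<mu> g \<longleftrightarrow> g \<in> borel_measurable \<mu> \<and> integrable \<mu> (\<lambda>x. (g x)\<^sup>2)"

definition l2_norm :: "'a measure \<Rightarrow> ('a \<Rightarrow> real) \<Rightarrow> real" where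
  "l2_norm \<mu> g = sqrt (\<integral>x. (g x)\<^sup>2 \<partial>\<mu>)"

text \<open>Vectors of \<open>\<real>\<^sup>M\<close> are extensional functions on \<open>{1..M}\<close>, since \<open>M\<close> is
  quantified inside the statements.\<close>

definition simplex_weights :: "nat \<Rightarrow> (nat \<Rightarrow> real) set" where
  "simplex_weights M = {\<theta> \<in> {1..M} \<rightarrow>\<^sub>E UNIV. (\<forall>j\<in>{1..M}. 0 \<le> \<theta> j) \<and> (\<Sum>j=1..M. \<theta> j) = 1}"

definition mixture :: "nat \<Rightarrow> (nat \<Rightarrow> 'a \<Rightarrow> real) \<Rightarrow> (nat \<Rightarrow> real) \<Rightarrow> 'a \<Rightarrow> real" where
  "mixture M F \<theta> = (\<lambda>x. \<Sum>j=1..M. \<theta> j * F j x)"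

definition empirical_risk ::
    "'a measure \<Rightarrow> nat \<Rightarrow> (nat \<Rightarrow> 'a) \<Rightarrow> ('a \<Rightarrow> real) \<Rightarrow> real" where
  "empirical_risk \<mu> n X g = (l2_norm \<mu> g)\<^sup>2 - 2 / real n * (\<Sum>i=1..n. g (X i))"

text \<open>A minimiser \<open>\<theta>\<close> need not be unique when the dictionary is linearly dependent, so
  being one is a predicate.\<close>

definition is_erm ::
    "'a measure \<Rightarrow> nat \<Rightarrow> (nat \<Rightarrow> 'a) \<Rightarrow> nat \<Rightarrow> (nat \<Rightarrow> 'a \<Rightarrow> real) \<Rightarrow> (nat \<Rightarrow> real) \<Rightarrow> bool" where
  "is_erm \<mu> n X M F \<theta> \<longleftrightarrow>
     is_arg_min (\<lambda>\<theta>. empirical_risk \<mu> n X (mixture M F \<theta>)) (\<lambda>\<theta>. \<theta> \<in> simplex_weights M) \<theta>"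

definition prob_density :: "'a measure \<Rightarrow> ('a \<Rightarrow> real) \<Rightarrow> bool" where
  "prob_density \<mu> f \<longleftrightarrow>
     f \<in> borel_measurable \<mu> \<and> (\<forall>x\<in>space \<mu>. 0 \<le> f x) \<and> prob_space (density \<mu> (\<lambda>x. ennreal (f x)))"

text \<open>The joint law of \<open>n\<close> i.i.d. observations with density \<open>f\<close>; the observations are the
  coordinates \<open>1, \<dots>, n\<close>.\<close>

definition iid_sample :: "'a measure \<Rightarrow> ('a \<Rightarrow> real) \<Rightarrow> nat \<Rightarrow> (nat \<Rightarrow> 'a) measure" where
  "iid_sample \<mu> f n = PiM {1..n} (\<lambda>_. density \<mu> (\<lambda>x. ennreal (f x)))"

end

theory Submission
  imports Defs
begin

text \<open>
  Cut \<open>[0, 1/L)\<close> into \<open>2 ^ m\<close> intervals of equal length, indexed by the subsets of \<open>{1..m}\<close>, and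
  let \<open>r\<^sub>j = \<plusminus>1\<close> on a cell according to whether \<open>j\<close> belongs to its index. For \<open>f = L\<close> on
  \<open>[0, 1/L)\<close> and the dictionary consisting of \<open>f\<close> and the functions \<open>f + L r\<^sub>j\<close>, the functions
  \<open>L r\<^sub>j\<close> are orthogonal, and the risk is, up to a constant, \<open>L (|\<theta>|\<^sup>2 - 2 \<langle>\<theta>, \<xi>\<rangle>)\<close>, where the
  \<open>\<xi>\<^sub>j\<close> are independent averages of \<open>n\<close> random signs. If the positive parts of the \<open>\<xi>\<^sub>j\<close> sum to
  at most \<open>1\<close>, they are the weights of the empirical minimiser on the perturbations, so its error
  is \<open>L\<close> times the sum of their squares, of order \<open>L m / n\<close>, whereas \<open>f\<close> itself has error \<open>0\<close>.
  With \<open>m\<close> of order \<open>\<surd>n\<close>, both conditions hold up to exponentially small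
  probability, by exponential moments of the positive parts and of their squares.
\<close>

section \<open>Moments of sums of random signs\<close>

text \<open>Sign vectors are encoded as sets, so averages over independent random signs become
  finite sums over \<open>Pow A\<close>.\<close>

definition spin :: "'a set \<Rightarrow> 'a \<Rightarrow> real" where
  "spin a i = (if i \<in> a then 1 else - 1)"

lemma sum_Pow_insert:
  assumes "finite A" "k \<notin> A"
  shows "(\<Sum>S\<in>Pow (insert k A). g S) = (\<Sum>S\<in>Pow A. g (insert k S) + g S :: real)"
proof -
  have inj: "inj_on (insert k) (Pow A)"
    using assms by (auto simp: inj_on_def)
  have "Pow A \<inter> insert k ` Pow A = {}" using assms by auto
  then have "(\<Sum>S\<in>Pow (insert k A). g S) = sum g (Pow A) + sum g (insert k ` Pow A)"
    using assms by (simp add: Pow_insert sum.union_disjoint)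
  then show ?thesis
    using inj by (simp add: sum.reindex sum.distrib)
qed

text \<open>Splits the cube by the sign at \<open>k\<close>. The arbitrary \<open>h\<close> lets
  squares, fourth powers and exponentials share one induction step.\<close>

lemma cube_sum_insert:
  fixes h :: "real \<Rightarrow> real"
  assumes "finite A" "k \<notin> A"
  shows "(\<Sum>a\<in>Pow (insert k A). h (\<Sum>i\<in>insert k A. w i * spin a i))
    = (\<Sum>a\<in>Pow A. h ((\<Sum>i\<in>A. w i * spin a i) + w k) + h ((\<Sum>i\<in>A. w i * spin a i) - w k))"
proof -
  have "(\<Sum>i\<in>A. w i * spin (insert k a) i) = (\<Sum>i\<in>A. w i * spin a i)" for a
    by (rule sum.cong) (use assms in \<open>auto simp: spin_def\<close>)
  moreover have "spin (insert k a) k = 1" for a by (simp add: spin_def)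
  moreover have "spin a k = - 1" if "a \<in> Pow A" for a using that assms by (auto simp: spin_def)
  ultimately show ?thesis
    using assms by (subst sum_Pow_insert) (auto intro!: sum.cong simp: algebra_simps)
qed

text \<open>Cross terms cancel because the signs are orthogonal. The induction generalises \<alpha>,
  since fixing one sign shifts it by \<open>w k\<close> or \<open>- w k\<close>.\<close>

lemma cube_sum_square:
  assumes "finite A"
  shows "(\<Sum>a\<in>Pow A. (\<alpha> + (\<Sum>i\<in>A. w i * spin a i))\<^sup>2) = 2 ^ card A * (\<alpha>\<^sup>2 + (\<Sum>i\<in>A. (w i)\<^sup>2))"
  using assms
proof (induction A arbitrary: \<alpha> rule: finite_induct)
  case (insert k A)
  have "(\<Sum>a\<in>Pow (insert k A). (\<alpha> + (\<Sum>i\<in>insert k A. w i * spin a i))\<^sup>2)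
    = (\<Sum>a\<in>Pow A. ((\<alpha> + w k) + (\<Sum>i\<in>A. w i * spin a i))\<^sup>2)
      + (\<Sum>a\<in>Pow A. ((\<alpha> - w k) + (\<Sum>i\<in>A. w i * spin a i))\<^sup>2)"
    using cube_sum_insert[OF insert.hyps, of "\<lambda>s. (\<alpha> + s)\<^sup>2" w]
    by (simp add: sum.distrib algebra_simps)
  also have "\<dots> = 2 ^ card (insert k A) * (\<alpha>\<^sup>2 + (\<Sum>i\<in>insert k A. (w i)\<^sup>2))"
    unfolding insert.IH using insert.hyps by (simp add: power2_eq_square algebra_simps)
  finally show ?case .
qed simp

lemma walk_sum_insert:
  fixes h :: "real \<Rightarrow> real"
  assumes "finite A" "k \<notin> A"
  shows "(\<Sum>a\<in>Pow (insert k A). h (\<Sum>i\<in>insert k A. spin a i))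
    = (\<Sum>a\<in>Pow A. h ((\<Sum>i\<in>A. spin a i) + 1) + h ((\<Sum>i\<in>A. spin a i) - 1))"
  using cube_sum_insert[OF assms, of h "\<lambda>_. 1"] by simp

text \<open>The induction runs over all \<open>h\<close> at once: the shifts
  \<open>h (s + 1)\<close> and \<open>h (s - 1)\<close> trade places under the sign change.\<close>

lemma walk_sum_uminus:
  fixes h :: "real \<Rightarrow> real"
  assumes "finite A"
  shows "(\<Sum>a\<in>Pow A. h (- (\<Sum>i\<in>A. spin a i))) = (\<Sum>a\<in>Pow A. h (\<Sum>i\<in>A. spin a i))"
  using assms
proof (induction A arbitrary: h rule: finite_induct)
  case (insert k A)
  show ?case
    using insert.IH[of "\<lambda>s. h (s + 1)"] insert.IH[of "\<lambda>s. h (s - 1)"]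
      walk_sum_insert[OF insert.hyps, of h] walk_sum_insert[OF insert.hyps, of "\<lambda>s. h (- s)"]
    by (simp add: sum.distrib)
qed simp

lemma walk_sum_exp:
  assumes "finite A"
  shows "(\<Sum>a\<in>Pow A. exp (t * (\<Sum>i\<in>A. spin a i))) = (exp t + exp (- t)) ^ card A"
  using assms
proof (induction A rule: finite_induct)
  case (insert k A)
  have "(\<Sum>a\<in>Pow (insert k A). exp (t * (\<Sum>i\<in>insert k A. spin a i)))
    = (\<Sum>a\<in>Pow A. (exp t + exp (- t)) * exp (t * (\<Sum>i\<in>A. spin a i)))"
    by (subst walk_sum_insert[OF insert.hyps, of "\<lambda>s. exp (t * s)"])
      (rule sum.cong, auto simp: algebra_simps exp_add exp_diff exp_minus divide_inverse)
  then show ?case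
    using insert by (simp flip: sum_distrib_left)
qed simp

lemma walk_sum_power2:
  assumes "finite A"
  shows "(\<Sum>a\<in>Pow A. (\<Sum>i\<in>A. spin a i)\<^sup>2) = 2 ^ card A * card A"
  using cube_sum_square[OF assms, of 0 "\<lambda>_. 1"] by simp

text \<open>On average a new sign adds \<open>6 s^2 + 1\<close> to \<open>s^4\<close>, so the second
  moment drives the recursion.\<close>

lemma walk_sum_power4:
  assumes "finite A"
  shows "(\<Sum>a\<in>Pow A. (\<Sum>i\<in>A. spin a i) ^ 4) = 2 ^ card A * (3 * (real (card A))\<^sup>2 - 2 * card A)"
  using assms
proof (induction A rule: finite_induct)
  case (insert k A)
  have "(s + 1) ^ 4 + (s - 1) ^ 4 = 2 * s ^ 4 + 12 * s\<^sup>2 + 2" for s :: real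
    by (simp add: power4_eq_xxxx power2_eq_square algebra_simps)
  then have "(\<Sum>a\<in>Pow (insert k A). (\<Sum>i\<in>insert k A. spin a i) ^ 4)
    = (\<Sum>a\<in>Pow A. 2 * (\<Sum>i\<in>A. spin a i) ^ 4 + 12 * (\<Sum>i\<in>A. spin a i)\<^sup>2 + 2)"
    by (subst walk_sum_insert[OF insert.hyps, of "\<lambda>s. s ^ 4"]) simp
  also have "\<dots> = 2 * (\<Sum>a\<in>Pow A. (\<Sum>i\<in>A. spin a i) ^ 4)
      + 12 * (\<Sum>a\<in>Pow A. (\<Sum>i\<in>A. spin a i)\<^sup>2) + 2 * 2 ^ card A"
    using insert.hyps by (simp add: sum.distrib card_Pow flip: sum_distrib_left)
  finally have "(\<Sum>a\<in>Pow (insert k A). (\<Sum>i\<in>insert k A. spin a i) ^ 4)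
    = 2 * (2 ^ card A * (3 * (real (card A))\<^sup>2 - 2 * card A)) + 12 * (2 ^ card A * card A) + 2 * 2 ^ card A"
    using insert by (simp add: walk_sum_power2)
  then show ?case
    using insert.hyps by (simp add: power2_eq_square algebra_simps)
qed simp

text \<open>By symmetry the positive and negative parts have equal moments. With
  \<open>p > 0\<close> the vanishing part contributes 0.\<close>

lemma walk_sum_even_pos_part:
  assumes "finite A" "p > 0"
  shows "(\<Sum>a\<in>Pow A. max 0 (\<Sum>i\<in>A. spin a i) ^ (2 * p)) = (\<Sum>a\<in>Pow A. (\<Sum>i\<in>A. spin a i) ^ (2 * p)) / 2"
proof -
  have "s ^ (2 * p) = max 0 s ^ (2 * p) + max 0 (- s) ^ (2 * p)" for s :: real
    using assms(2) by (cases "s \<ge> 0") (auto simp: max_def)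
  then have "(\<Sum>a\<in>Pow A. (\<Sum>i\<in>A. spin a i) ^ (2 * p))
    = (\<Sum>a\<in>Pow A. max 0 (\<Sum>i\<in>A. spin a i) ^ (2 * p))
      + (\<Sum>a\<in>Pow A. max 0 (- (\<Sum>i\<in>A. spin a i)) ^ (2 * p))"
    by (metis (mono_tags, lifting) sum.cong sum.distrib)
  then show ?thesis
    using walk_sum_uminus[OF assms(1), of "\<lambda>s. max 0 s ^ (2 * p)"] by simp
qed

section \<open>Exponential moments of the positive part\<close>

text \<open>Follows from \<open>(1 + x) (1 - x + x^2) = 1 + x^3\<close> and
  \<open>1 + x \<le> exp x\<close>.\<close>

lemma exp_neg_le_quadratic:
  fixes x :: real
  assumes "x \<ge> 0"
  shows "exp (- x) \<le> 1 - x + x\<^sup>2"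
proof -
  have "1 \<le> (1 + x) * (1 - x + x\<^sup>2)"
    using assms by (simp add: algebra_simps power2_eq_square)
  also have "\<dots> \<le> exp x * (1 - x + x\<^sup>2)"
  proof (intro mult_right_mono exp_ge_add_one_self)
    have "0 \<le> (x - 1/2)\<^sup>2" by simp
    then show "0 \<le> 1 - x + x\<^sup>2" by (simp add: power2_eq_square algebra_simps)
  qed
  finally show ?thesis
    by (simp add: exp_minus field_simps)
qed

text \<open>Since \<open>exp (max 0 s) \<le> 1 + exp s\<close>, it suffices to bound the moment
  generating function, whose average at \<open>1 / sqrt n\<close> is bounded independently of
  \<open>n\<close>.\<close>

lemma walk_sum_exp_pos_part_le:
  assumes "finite A" "A \<noteq> {}"
  shows "(\<Sum>a\<in>Pow A. exp (max 0 (\<Sum>i\<in>A. spin a i) / sqrt (card A))) \<le> 2 ^ card A * exp 2"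
proof -
  define n where "n = card A"
  define t where "t = 1 / sqrt n"
  have n: "n \<ge> 1" using assms by (simp add: n_def Suc_le_eq card_gt_0_iff)
  then have t: "0 \<le> t" "t \<le> 1" "n * t\<^sup>2 = 1"
    by (auto simp: t_def power_divide)
  \<comment> \<open>The linear terms cancel, so each sign costs only a factor
    \<open>1 + t^2\<close>, at most \<open>exp (1 / n)\<close>.\<close>
  have "exp t + exp (- t) \<le> 2 * (1 + t\<^sup>2)"
    using exp_neg_le_quadratic[of t] exp_bound[of t] t by simp
  also have "\<dots> \<le> 2 * exp (t\<^sup>2)"
    by (intro mult_left_mono exp_ge_add_one_self) simp
  finally have "(exp t + exp (- t)) ^ n \<le> (2 * exp (t\<^sup>2)) ^ n"
    by (rule power_mono) (simp add: add_nonneg_nonneg)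
  also have "\<dots> = 2 ^ n * exp 1"
    using t(3) by (simp add: power_mult_distrib flip: exp_of_nat_mult)
  finally have mgf: "(\<Sum>a\<in>Pow A. exp (t * (\<Sum>i\<in>A. spin a i))) \<le> 2 ^ n * exp 1"
    using walk_sum_exp[OF assms(1)] by (simp add: n_def)
  have "(\<Sum>a\<in>Pow A. exp (max 0 (\<Sum>i\<in>A. spin a i) / sqrt (card A)))
    \<le> (\<Sum>a\<in>Pow A. 1 + exp (t * (\<Sum>i\<in>A. spin a i)))"
    by (rule sum_mono) (auto simp: t_def n_def max_def)
  also have "\<dots> \<le> 2 ^ n * (1 + exp 1)"
    using mgf assms by (simp add: sum.distrib card_Pow n_def algebra_simps)
  \<comment> \<open>A pure exponential turns into \<open>exp (2 * m)\<close> when the bound is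
    raised to the power \<open>m\<close>.\<close>
  also have "1 + exp 1 \<le> (exp 2 :: real)"
  proof -
    have "2 \<le> exp (1 :: real)" using exp_ge_add_one_self[of 1] by simp
    moreover have "2 * exp 1 \<le> exp 1 * (exp 1 :: real)"
      using calculation by (intro mult_right_mono) auto
    moreover have "exp 1 * exp 1 = (exp 2 :: real)" by (simp flip: exp_add)
    ultimately show ?thesis by linarith
  qed
  finally show ?thesis by (simp add: n_def)
qed

text \<open>The squared positive part divided by \<open>n\<close> has mean 1/2 and second moment at
  most 3/2, so expanding \<open>exp (- t x)\<close> to second order gives at most
  \<open>1 - t / 2 + 3 t^2 / 2\<close>. The choice \<open>t = 1 / 6\<close> minimises this, with
  value \<open>1 - 1 / 24\<close>.\<close>

lemma walk_sum_exp_neg_square_le: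
  assumes "finite A" "A \<noteq> {}"
  shows "(\<Sum>a\<in>Pow A. exp (- (max 0 (\<Sum>i\<in>A. spin a i))\<^sup>2 / (6 * card A))) \<le> 2 ^ card A * exp (- 1 / 24)"
proof -
  define n where "n = real (card A)"
  have n: "n > 0" using assms by (simp add: n_def card_gt_0_iff)
  let ?P = "\<lambda>a. max 0 (\<Sum>i\<in>A. spin a i)"
  have "(\<Sum>a\<in>Pow A. exp (- (?P a)\<^sup>2 / (6 * n)))
    \<le> (\<Sum>a\<in>Pow A. 1 - (?P a)\<^sup>2 / (6 * n) + (?P a) ^ 4 / (36 * n\<^sup>2))"
  proof (rule sum_mono)
    fix a
    show "exp (- (?P a)\<^sup>2 / (6 * n)) \<le> 1 - (?P a)\<^sup>2 / (6 * n) + (?P a) ^ 4 / (36 * n\<^sup>2)"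
      using exp_neg_le_quadratic[of "(?P a)\<^sup>2 / (6 * n)"] n
      by (simp add: power_divide power_mult_distrib)
  qed
  also have "\<dots> = 2 ^ card A - (\<Sum>a\<in>Pow A. (?P a)\<^sup>2) / (6 * n) + (\<Sum>a\<in>Pow A. (?P a) ^ 4) / (36 * n\<^sup>2)"
    using assms by (simp add: sum.distrib sum_subtractf card_Pow sum_divide_distrib)
  also have "(\<Sum>a\<in>Pow A. (?P a)\<^sup>2) = 2 ^ card A * n / 2"
    using walk_sum_even_pos_part[OF assms(1), of 1] walk_sum_power2[OF assms(1)] by (simp add: n_def)
  also have "(\<Sum>a\<in>Pow A. (?P a) ^ 4) = 2 ^ card A * (3 * n\<^sup>2 - 2 * n) / 2"
    using walk_sum_even_pos_part[OF assms(1), of 2] walk_sum_power4[OF assms(1)] by (simp add: n_def)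
  also have "2 ^ card A - 2 ^ card A * n / 2 / (6 * n) + 2 ^ card A * (3 * n\<^sup>2 - 2 * n) / 2 / (36 * n\<^sup>2)
    = 2 ^ card A * (1 - 1 / 24 - 1 / (36 * n))"
    using n by (simp add: field_simps power2_eq_square)
  also have "\<dots> \<le> 2 ^ card A * exp (- 1 / 24)"
  proof (intro mult_left_mono)
    have "1 - 1 / 24 \<le> exp (- 1 / 24 :: real)"
      using exp_ge_add_one_self[of "- 1 / 24 :: real"] by linarith
    moreover have "0 \<le> 1 / (36 * n)" using n by simp
    ultimately show "1 - 1 / 24 - 1 / (36 * n) \<le> exp (- 1 / 24)" by linarith
  qed simp
  finally show ?thesis by (simp add: n_def)
qed

section \<open>Counting the sign matrices that force a large error\<close>

text \<open>Transposing the sign matrix replaces its rows \<open>b i\<close> by its columns, which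
  range independently over \<open>Pow I\<close>; the sum therefore factorises over
  \<open>J\<close>.\<close>

lemma sum_prod_spin_matrix:
  fixes h :: "real \<Rightarrow> real"
  assumes "finite I" "finite J"
  shows "(\<Sum>b\<in>I \<rightarrow>\<^sub>E Pow J. \<Prod>j\<in>J. h (\<Sum>i\<in>I. spin (b i) j)) = (\<Sum>a\<in>Pow I. h (\<Sum>i\<in>I. spin a i)) ^ card J"
proof -
  have "(\<Sum>b\<in>I \<rightarrow>\<^sub>E Pow J. \<Prod>j\<in>J. h (\<Sum>i\<in>I. spin (b i) j))
    = (\<Sum>a\<in>J \<rightarrow>\<^sub>E Pow I. \<Prod>j\<in>J. h (\<Sum>i\<in>I. spin (a j) i))"
  proof (rule sum.reindex_bij_witness[where
        i = "\<lambda>a. \<lambda>i\<in>I. {j \<in> J. i \<in> a j}" and j = "\<lambda>b. \<lambda>j\<in>J. {i \<in> I. j \<in> b i}"])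
    fix b assume "b \<in> I \<rightarrow>\<^sub>E Pow J"
    then show "(\<lambda>i\<in>I. {j \<in> J. i \<in> (\<lambda>j\<in>J. {i \<in> I. j \<in> b i}) j}) = b"
      by (fastforce simp: fun_eq_iff PiE_iff extensional_def)
  next
    fix a assume "a \<in> J \<rightarrow>\<^sub>E Pow I"
    then show "(\<lambda>j\<in>J. {i \<in> I. j \<in> (\<lambda>i\<in>I. {j \<in> J. i \<in> a j}) i}) = a"
      by (fastforce simp: fun_eq_iff PiE_iff extensional_def)
  qed (auto simp: spin_def intro!: prod.cong arg_cong[of _ _ h] sum.cong)
  also have "\<dots> = (\<Prod>j\<in>J. \<Sum>a\<in>Pow I. h (\<Sum>i\<in>I. spin a i))"
    using assms by (subst prod_sum_PiE) auto
  finally show ?thesis by simp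
qed

text \<open>Markov's inequality for the uniform distribution, in counting form.\<close>

lemma card_le_sum_weight:
  fixes w :: "'a \<Rightarrow> real"
  assumes "finite \<Omega>" "\<And>b. b \<in> \<Omega> \<Longrightarrow> 0 \<le> w b" "\<And>b. b \<in> \<Omega> \<Longrightarrow> P b \<Longrightarrow> 1 \<le> w b"
  shows "card {b \<in> \<Omega>. P b} \<le> sum w \<Omega>"
proof -
  have "real (card {b \<in> \<Omega>. P b}) = (\<Sum>b\<in>{b \<in> \<Omega>. P b}. 1)" by simp
  also have "\<dots> \<le> sum w {b \<in> \<Omega>. P b}" by (rule sum_mono) (use assms in auto)
  also have "\<dots> \<le> sum w \<Omega>" by (rule sum_mono2) (use assms in auto)
  finally show ?thesis .
qed

text \<open>Here \<open>b i\<close> is the cell of observation \<open>i\<close>. After division by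
  \<open>n\<close>, the first condition makes the positive parts admissible as weights, and the
  second bounds the sum of their squares below by \<open>m / (8 n)\<close>. The threshold
  \<open>m * n / 8\<close> is a quarter of the mean \<open>m * n / 2\<close>, which leaves room for
  an exponential tail bound.\<close>

definition good_cells :: "nat \<Rightarrow> nat \<Rightarrow> (nat \<Rightarrow> nat set) set" where
  "good_cells n m = {b \<in> {1..n} \<rightarrow>\<^sub>E Pow {1..m}.
     (\<Sum>j=1..m. max 0 (\<Sum>i=1..n. spin (b i) j)) \<le> n \<and>
     m * n / 8 \<le> (\<Sum>j=1..m. (max 0 (\<Sum>i=1..n. spin (b i) j))\<^sup>2)}"

text \<open>A union bound over the two failures, each controlled by a Chernoff weight that is a
  product over the coordinates \<open>j\<close>.\<close>

lemma card_good_cells: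
  assumes "n \<ge> 1" "4 * real m \<le> sqrt n"
  shows "(2 ^ m) ^ n * (1 - 2 * exp (- real m / 48)) \<le> card (good_cells n m)"
proof -
  let ?\<Omega> = "{1..n} \<rightarrow>\<^sub>E Pow {1..m}"
  let ?P = "\<lambda>b j. max 0 (\<Sum>i=1..n. spin (b i) j)"
  define N :: real where "N = (2 ^ m) ^ n"
  have N': "(2 ^ n) ^ m = N" by (simp add: N_def mult.commute flip: power_mult)
  have fin: "finite ?\<Omega>" by (intro finite_PiE) auto
  have "card {b \<in> ?\<Omega>. n < (\<Sum>j=1..m. ?P b j)}
    \<le> (\<Sum>b\<in>?\<Omega>. exp (- sqrt n) * (\<Prod>j=1..m. exp (?P b j / sqrt n)))"
  proof (rule card_le_sum_weight[OF fin])
    fix b assume "n < (\<Sum>j=1..m. ?P b j)"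
    then have "sqrt n \<le> (\<Sum>j=1..m. ?P b j / sqrt n)"
      using assms(1) by (simp add: field_simps flip: sum_divide_distrib)
    then show "1 \<le> exp (- sqrt n) * (\<Prod>j=1..m. exp (?P b j / sqrt n))"
      by (simp flip: exp_sum exp_add)
  qed (simp add: prod_nonneg)
  also have "\<dots> = exp (- sqrt n) * (\<Sum>a\<in>Pow {1..n}. exp (max 0 (\<Sum>i=1..n. spin a i) / sqrt n)) ^ m"
    using sum_prod_spin_matrix[of "{1..n}" "{1..m}" "\<lambda>s. exp (max 0 s / sqrt n)"]
    by (simp flip: sum_distrib_left)
  also have "\<dots> \<le> exp (- sqrt n) * (2 ^ n * exp 2) ^ m"
    using walk_sum_exp_pos_part_le[of "{1..n}"] assms(1)
    by (intro mult_left_mono power_mono sum_nonneg) auto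
  also have "\<dots> = N * exp (2 * m - sqrt n)"
    by (simp add: power_mult_distrib N' exp_diff exp_minus field_simps flip: exp_of_nat_mult)
  \<comment> \<open>The hypothesis gives \<open>2 * m - sqrt n \<le> - 2 * m\<close>, far below
    \<open>- m / 48\<close>.\<close>
  also have "\<dots> \<le> N * exp (- real m / 48)"
    using assms(2) by (intro mult_left_mono) (auto simp: N_def)
  finally have bad1: "card {b \<in> ?\<Omega>. n < (\<Sum>j=1..m. ?P b j)} \<le> N * exp (- real m / 48)" .
  \<comment> \<open>The prefactor exponent \<open>m / 48\<close> is the threshold
    \<open>m * n / 8\<close> divided by \<open>6 * n\<close>. It uses up half of the gain
    \<open>m / 24\<close> of the moment bound.\<close>
  have "card {b \<in> ?\<Omega>. (\<Sum>j=1..m. (?P b j)\<^sup>2) < m * n / 8}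
    \<le> (\<Sum>b\<in>?\<Omega>. exp (m / 48) * (\<Prod>j=1..m. exp (- (?P b j)\<^sup>2 / (6 * n))))"
  proof (rule card_le_sum_weight[OF fin])
    fix b assume "(\<Sum>j=1..m. (?P b j)\<^sup>2) < m * n / 8"
    then have "0 \<le> m / 48 + (\<Sum>j=1..m. - (?P b j)\<^sup>2 / (6 * n))"
      using assms(1) by (simp add: field_simps sum_negf flip: sum_divide_distrib)
    then show "1 \<le> exp (m / 48) * (\<Prod>j=1..m. exp (- (?P b j)\<^sup>2 / (6 * n)))"
      by (simp flip: exp_sum exp_add)
  qed (simp add: prod_nonneg)
  also have "\<dots> = exp (m / 48) * (\<Sum>a\<in>Pow {1..n}. exp (- (max 0 (\<Sum>i=1..n. spin a i))\<^sup>2 / (6 * n))) ^ m"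
    using sum_prod_spin_matrix[of "{1..n}" "{1..m}" "\<lambda>s. exp (- (max 0 s)\<^sup>2 / (6 * n))"]
    by (simp flip: sum_distrib_left)
  also have "\<dots> \<le> exp (m / 48) * (2 ^ n * exp (- 1 / 24)) ^ m"
    using walk_sum_exp_neg_square_le[of "{1..n}"] assms(1)
    by (intro mult_left_mono power_mono sum_nonneg) auto
  also have "\<dots> = N * exp (- real m / 48)"
    by (simp add: power_mult_distrib N' flip: exp_of_nat_mult exp_add)
  finally have bad2: "card {b \<in> ?\<Omega>. (\<Sum>j=1..m. (?P b j)\<^sup>2) < m * n / 8} \<le> N * exp (- real m / 48)" .
  have "?\<Omega> \<subseteq> good_cells n m \<union> {b \<in> ?\<Omega>. n < (\<Sum>j=1..m. ?P b j)}
      \<union> {b \<in> ?\<Omega>. (\<Sum>j=1..m. (?P b j)\<^sup>2) < m * n / 8}" (is "_ \<subseteq> ?G \<union> ?A \<union> ?B")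
    by (auto simp: good_cells_def)
  then have "card ?\<Omega> \<le> card (?G \<union> ?A \<union> ?B)"
    using fin by (intro card_mono) (auto simp: good_cells_def)
  also have "\<dots> \<le> card ?G + card ?A + card ?B"
    by (meson add_le_cancel_right card_Un_le le_trans)
  finally have "card ?\<Omega> \<le> card ?G + card ?A + card ?B" .
  moreover have "real (card ?\<Omega>) = N" by (simp add: card_PiE card_Pow N_def)
  ultimately have "N \<le> card ?G + N * exp (- real m / 48) + N * exp (- real m / 48)"
    using bad1 bad2 by linarith
  then show ?thesis by (simp add: N_def algebra_simps)
qed

lemma l2_norm_power2: "(l2_norm \<mu> g)\<^sup>2 = (\<integral>x. (g x)\<^sup>2 \<partial>\<mu>)"
  by (simp add: l2_norm_def)

section \<open>Cells, density and dictionary\<close>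

text \<open>Only the labels of the cells and their measures matter below, so the partition enters as
  a labelling \<open>c\<close>, with \<open>None\<close> outside the support.\<close>

locale cell_map =
  fixes L :: real and m :: nat and c :: "real \<Rightarrow> nat set option"
  assumes L_pos: "0 < L"
    and c_measurable: "c \<in> borel \<rightarrow>\<^sub>M count_space (insert None (Some ` Pow {1..m}))"
    and cell_measure: "\<And>S. S \<subseteq> {1..m} \<Longrightarrow> emeasure lborel (c -` {Some S}) = ennreal (1 / (2 ^ m * L))"
begin

lemma c_range: "c x \<in> insert None (Some ` Pow {1..m})"
  using measurable_space[OF c_measurable, of x] by simp

lemma c_cases:
  obtains "c x = None" | S where "c x = Some S" "S \<subseteq> {1..m}"
  using c_range[of x] by auto

lemma cell_sets: "c -` {v} \<in> sets borel"
proof (cases "v \<in> insert None (Some ` Pow {1..m})")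
  case True
  then show ?thesis using measurable_sets[OF c_measurable, of "{v}"] by simp
next
  case False
  have "c x \<noteq> v" for x using c_range[of x] False by metis
  then have "c -` {v} = {}" by auto
  then show ?thesis by simp
qed

lemma cell_nonempty: "S \<subseteq> {1..m} \<Longrightarrow> \<exists>x. c x = Some S"
  using cell_measure[of S] L_pos by (cases "c -` {Some S} = {}") auto

text \<open>A function of the label is a finite combination of cell indicators. The value at
  \<open>None\<close> must vanish because the complement of the cells has infinite measure.\<close>

lemma cells_has_integral:
  fixes g :: "nat set option \<Rightarrow> real"
  assumes "g None = 0"
  shows "has_bochner_integral lborel (\<lambda>x. g (c x)) ((\<Sum>S\<in>Pow {1..m}. g (Some S)) / (2 ^ m * L))"
proof -
  have "g (c x) = (\<Sum>S\<in>Pow {1..m}. indicator (c -` {Some S}) x * g (Some S))" for x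
    by (cases x rule: c_cases)
      (auto simp: assms indicator_def if_distrib[of "\<lambda>t. t * _"] cong: if_cong)
  moreover have "has_bochner_integral lborel (\<lambda>x. indicator (c -` {Some S}) x * g (Some S))
      (g (Some S) / (2 ^ m * L))" if "S \<in> Pow {1..m}" for S
  proof -
    have "measure lborel (c -` {Some S}) = 1 / (2 ^ m * L)"
      using cell_measure[of S] that L_pos by (simp add: measure_def)
    then show ?thesis
      using has_bochner_integral_mult_left[of "g (Some S)" lborel "indicator (c -` {Some S})" "1 / (2 ^ m * L)"]
        has_bochner_integral_real_indicator[of "c -` {Some S}" lborel] cell_measure[of S] that cell_sets
      by simp
  qed
  ultimately show ?thesis
    unfolding sum_divide_distrib by (simp only: has_bochner_integral_sum)
qed

lemma cells_integral:
  fixes g :: "nat set option \<Rightarrow> real"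
  assumes "g None = 0"
  shows "(\<integral>x. g (c x) \<partial>lborel) = (\<Sum>S\<in>Pow {1..m}. g (Some S)) / (2 ^ m * L)"
  using cells_has_integral[of g] assms by (simp add: has_bochner_integral_integral_eq)

definition cell_density :: "real \<Rightarrow> real" where
  "cell_density x = (if c x = None then 0 else L)"

text \<open>The last index \<open>Suc m\<close> is the true density; the others are its perturbations by \<open>\<plusminus> L\<close>.\<close>

definition dict :: "nat \<Rightarrow> real \<Rightarrow> real" where
  "dict j x = (case c x of None \<Rightarrow> 0 | Some S \<Rightarrow> L * (1 + (if j \<le> m then spin S j else 0)))"

lemma comp_c_measurable: "(\<lambda>x. g (c x) :: real) \<in> borel_measurable borel"
  using measurable_compose[OF c_measurable, of g borel] by simp

lemma square_integrable_dict: "square_integrable lborel (dict j)"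
  using comp_c_measurable[of "case_option 0 (\<lambda>S. L * (1 + (if j \<le> m then spin S j else 0)))"]
    cells_has_integral[of "\<lambda>v. (case_option 0 (\<lambda>S. L * (1 + (if j \<le> m then spin S j else 0))) v)\<^sup>2"]
  by (auto simp: square_integrable_def dict_def[abs_def] integrable.simps)

lemma abs_dict_le: "\<bar>dict j x\<bar> \<le> 2 * L"
  using L_pos by (auto simp: dict_def spin_def split: option.split)

lemma inj_on_dict: "inj_on dict {1..Suc m}"
proof (rule linorder_inj_onI)
  fix i j assume ij: "i < j" "i \<in> {1..Suc m}" "j \<in> {1..Suc m}"
  \<comment> \<open>Here \<open>i \<le> m\<close>. On the cell \<open>{i}\<close> the function
    \<open>dict i\<close> is \<open>2 * L\<close>, while \<open>dict j\<close> is 0, or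
    \<open>L\<close> if \<open>j = Suc m\<close>.\<close>
  obtain x where x: "c x = Some {i}"
    using cell_nonempty[of "{i}"] ij by auto
  then have "dict i x \<noteq> dict j x"
    using ij L_pos by (auto simp: dict_def spin_def)
  then show "dict i \<noteq> dict j" by auto
qed auto

lemma emeasure_density_cell:
  assumes "S \<subseteq> {1..m}"
  shows "emeasure (density lborel (\<lambda>x. ennreal (cell_density x))) (c -` {Some S}) = ennreal (1 / 2 ^ m)"
proof -
  have "emeasure (density lborel (\<lambda>x. ennreal (cell_density x))) (c -` {Some S})
    = (\<integral>\<^sup>+x. ennreal L * indicator (c -` {Some S}) x \<partial>lborel)"
    using comp_c_measurable[of "\<lambda>v. if v = None then 0 else L"] cell_sets
    by (subst emeasure_density) (auto simp: cell_density_def[abs_def] indicator_def intro!: nn_integral_cong)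
  also have "\<dots> = ennreal L * ennreal (1 / (2 ^ m * L))"
    using cell_sets by (simp add: nn_integral_cmult cell_measure[OF assms])
  also have "\<dots> = ennreal (1 / 2 ^ m)"
    using L_pos by (simp flip: ennreal_mult)
  finally show ?thesis .
qed

lemma prob_density_cell_density: "prob_density lborel cell_density"
proof -
  have meas: "cell_density \<in> borel_measurable borel"
    using comp_c_measurable[of "\<lambda>v. if v = None then 0 else L"] by (simp add: cell_density_def[abs_def])
  have "has_bochner_integral lborel cell_density 1"
    using cells_has_integral[of "\<lambda>v. if v = None then 0 else L"] L_pos
    by (simp add: cell_density_def[abs_def] card_Pow)
  then have "(\<integral>\<^sup>+x. ennreal (cell_density x) \<partial>lborel) = 1"
    using L_pos by (subst nn_integral_eq_integral)
      (auto simp: cell_density_def has_bochner_integral_iff)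
  then have "prob_space (density lborel (\<lambda>x. ennreal (cell_density x)))"
    using meas by (intro prob_spaceI) (simp add: emeasure_density)
  then show ?thesis
    using meas L_pos by (auto simp: prob_density_def cell_density_def)
qed

section \<open>Norms of mixtures\<close>

text \<open>As the weights sum to 1, the unperturbed terms add up to the density and the last weight
  drops out.\<close>

lemma mixture_dict:
  assumes "\<theta> \<in> simplex_weights (Suc m)"
  shows "mixture (Suc m) dict \<theta> x
    = (case c x of None \<Rightarrow> 0 | Some S \<Rightarrow> L * (1 + (\<Sum>j=1..m. \<theta> j * spin S j)))"
proof (cases x rule: c_cases)
  case 1
  then show ?thesis by (simp add: mixture_def dict_def)
next
  case (2 S)
  have "mixture (Suc m) dict \<theta> x = (\<Sum>j=1..m. \<theta> j * (L * (1 + spin S j))) + \<theta> (Suc m) * L"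
    using 2 by (simp add: mixture_def dict_def)
  also have "\<dots> = L * ((\<Sum>j=1..Suc m. \<theta> j) + (\<Sum>j=1..m. \<theta> j * spin S j))"
    by (simp add: algebra_simps sum.distrib sum_distrib_left)
  also have "(\<Sum>j=1..Suc m. \<theta> j) = 1"
    using assms by (simp add: simplex_weights_def)
  finally show ?thesis using 2 by simp
qed

text \<open>Taking \<alpha> = 1 gives the norm of a mixture, and \<alpha> = 0 that of its difference
  from the density.\<close>

lemma cells_integral_square:
  "(\<Sum>S\<in>Pow {1..m}. (L * (\<alpha> + (\<Sum>j=1..m. \<theta> j * spin S j)))\<^sup>2) / (2 ^ m * L) = L * (\<alpha>\<^sup>2 + (\<Sum>j=1..m. (\<theta> j)\<^sup>2))"
proof -
  have "(\<Sum>S\<in>Pow {1..m}. (L * (\<alpha> + (\<Sum>j=1..m. \<theta> j * spin S j)))\<^sup>2)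
    = L\<^sup>2 * (2 ^ m * (\<alpha>\<^sup>2 + (\<Sum>j=1..m. (\<theta> j)\<^sup>2)))"
    using cube_sum_square[of "{1..m}" \<alpha> \<theta>] by (simp add: power_mult_distrib flip: sum_distrib_left)
  then show ?thesis using L_pos by (simp add: power2_eq_square)
qed

lemma l2_norm_mixture:
  assumes "\<theta> \<in> simplex_weights (Suc m)"
  shows "(l2_norm lborel (mixture (Suc m) dict \<theta>))\<^sup>2 = L * (1 + (\<Sum>j=1..m. (\<theta> j)\<^sup>2))"
  using cells_integral[of "\<lambda>v. (case v of None \<Rightarrow> 0 | Some S \<Rightarrow> L * (1 + (\<Sum>j=1..m. \<theta> j * spin S j)))\<^sup>2"]
    cells_integral_square[of 1 \<theta>]
  by (simp add: l2_norm_power2 mixture_dict[OF assms])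

lemma l2_norm_mixture_minus:
  assumes "\<theta> \<in> simplex_weights (Suc m)"
  shows "(l2_norm lborel (\<lambda>x. mixture (Suc m) dict \<theta> x - cell_density x))\<^sup>2 = L * (\<Sum>j=1..m. (\<theta> j)\<^sup>2)"
proof -
  have "mixture (Suc m) dict \<theta> x - cell_density x
    = (case c x of None \<Rightarrow> 0 | Some S \<Rightarrow> L * (0 + (\<Sum>j=1..m. \<theta> j * spin S j)))" for x
    by (simp add: mixture_dict[OF assms] cell_density_def algebra_simps split: option.split)
  then show ?thesis
    using cells_integral[of "\<lambda>v. (case v of None \<Rightarrow> 0 | Some S \<Rightarrow> L * (0 + (\<Sum>j=1..m. \<theta> j * spin S j)))\<^sup>2"]
      cells_integral_square[of 0 \<theta>]
    by (simp add: l2_norm_power2)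
qed

lemma Min_dict_le: "Min ((\<lambda>j. (l2_norm lborel (\<lambda>x. dict j x - cell_density x))\<^sup>2) ` {1..Suc m}) \<le> 0"
proof -
  have "dict (Suc m) x = cell_density x" for x
    by (simp add: dict_def cell_density_def split: option.split)
  then have "(l2_norm lborel (\<lambda>x. dict (Suc m) x - cell_density x))\<^sup>2 = 0"
    by (simp add: l2_norm_def)
  then show ?thesis
    by (intro Min_le) (auto intro!: image_eqI[of _ _ "Suc m"])
qed

section \<open>Empirical risk minimisers\<close>

lemma erm_simplex: "is_erm lborel n X (Suc m) dict \<theta> \<Longrightarrow> \<theta> \<in> simplex_weights (Suc m)"
  by (simp add: is_erm_def is_arg_min_def)

lemma erm_risk_le:
  assumes "is_erm lborel n X (Suc m) dict \<theta>" "\<theta>' \<in> simplex_weights (Suc m)"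
  shows "empirical_risk lborel n X (mixture (Suc m) dict \<theta>) \<le> empirical_risk lborel n X (mixture (Suc m) dict \<theta>')"
  using assms by (auto simp: is_erm_def is_arg_min_def not_less)

lemma empirical_risk_cong:
  assumes "\<forall>i\<in>{1..n}. c (X i) = c (X' i)"
  shows "empirical_risk lborel n X (mixture (Suc m) dict \<theta>) = empirical_risk lborel n X' (mixture (Suc m) dict \<theta>)"
  using assms by (simp add: empirical_risk_def mixture_def dict_def)

text \<open>The selector \<open>\<theta>_erm\<close> is arbitrary, so measurability of the event is not automatic:
  it holds because the error of a minimiser depends only on the cells hit by the sample.\<close>

lemma erm_error_unique:
  assumes "is_erm lborel n X (Suc m) dict \<theta>" "is_erm lborel n X' (Suc m) dict \<theta>'"
    and cells: "\<forall>i\<in>{1..n}. c (X i) = c (X' i)"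
  shows "(\<Sum>j=1..m. (\<theta> j)\<^sup>2) = (\<Sum>j=1..m. (\<theta>' j)\<^sup>2)"
proof -
  let ?R = "\<lambda>\<theta>. empirical_risk lborel n X (mixture (Suc m) dict \<theta>)"
  \<comment> \<open>Strict convexity in the first \<open>m\<close> weights: by the parallelogram
    identity, the midpoint would have smaller risk than the average of the two minimisers if they
    differed there.\<close>
  define \<eta> where "\<eta> = (\<lambda>j\<in>{1..Suc m}. (\<theta> j + \<theta>' j) / 2)"
  have \<theta>: "\<theta> \<in> simplex_weights (Suc m)" "\<theta>' \<in> simplex_weights (Suc m)"
    using assms erm_simplex by auto
  then have \<eta>: "\<eta> \<in> simplex_weights (Suc m)"
    by (auto simp: simplex_weights_def \<eta>_def sum.distrib add_divide_distrib
        simp del: sum.cl_ivl_Suc simp flip: sum_divide_distrib)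
  have mid: "mixture (Suc m) dict \<eta> x = (mixture (Suc m) dict \<theta> x + mixture (Suc m) dict \<theta>' x) / 2" for x
    by (simp add: mixture_def \<eta>_def add_divide_distrib sum_divide_distrib algebra_simps sum.distrib
        del: sum.cl_ivl_Suc)
  have "(\<eta> j)\<^sup>2 = (\<theta> j)\<^sup>2 / 2 + (\<theta>' j)\<^sup>2 / 2 - (\<theta> j - \<theta>' j)\<^sup>2 / 4" if "j \<in> {1..m}" for j
    using that by (simp add: \<eta>_def power2_eq_square field_simps)
  then have "(\<Sum>j=1..m. (\<eta> j)\<^sup>2)
    = (\<Sum>j=1..m. (\<theta> j)\<^sup>2) / 2 + (\<Sum>j=1..m. (\<theta>' j)\<^sup>2) / 2 - (\<Sum>j=1..m. (\<theta> j - \<theta>' j)\<^sup>2) / 4"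
    by (simp add: sum.distrib sum_subtractf sum_divide_distrib)
  moreover have "(\<Sum>i=1..n. mixture (Suc m) dict \<eta> (X i))
    = (\<Sum>i=1..n. mixture (Suc m) dict \<theta> (X i)) / 2 + (\<Sum>i=1..n. mixture (Suc m) dict \<theta>' (X i)) / 2"
    by (simp add: mid add_divide_distrib sum.distrib sum_divide_distrib)
  ultimately have "?R \<eta> = ?R \<theta> / 2 + ?R \<theta>' / 2 - L * (\<Sum>j=1..m. (\<theta> j - \<theta>' j)\<^sup>2) / 4"
    unfolding empirical_risk_def l2_norm_mixture[OF \<theta>(1)] l2_norm_mixture[OF \<theta>(2)] l2_norm_mixture[OF \<eta>]
    by (simp only:) argo
  moreover have "?R \<theta> \<le> ?R \<eta>" "?R \<theta>' \<le> ?R \<eta>"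
    using erm_risk_le[OF assms(1) \<eta>] erm_risk_le[OF assms(2) \<eta>] empirical_risk_cong[OF cells] by simp_all
  ultimately have "L * (\<Sum>j=1..m. (\<theta> j - \<theta>' j)\<^sup>2) \<le> 0" by linarith
  then have "(\<Sum>j=1..m. (\<theta> j - \<theta>' j)\<^sup>2) = 0"
    using L_pos by (intro antisym sum_nonneg) (auto simp: mult_le_0_iff)
  then have "\<forall>j\<in>{1..m}. \<theta> j = \<theta>' j" by (subst (asm) sum_nonneg_eq_0_iff) auto
  then show ?thesis by simp
qed

text \<open>Exhibits the risk as a separable quadratic: up to a constant, \<open>L\<close> times the
  squared distance of the first \<open>m\<close> weights from the averaged signs.\<close>

lemma empirical_risk_cells:
  assumes "n \<ge> 1" and b: "\<forall>i\<in>{1..n}. c (X i) = Some (b i)" and \<theta>: "\<theta> \<in> simplex_weights (Suc m)"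
  shows "empirical_risk lborel n X (mixture (Suc m) dict \<theta>)
    = L * (\<Sum>j=1..m. (\<theta> j)\<^sup>2 - 2 * \<theta> j * ((\<Sum>i=1..n. spin (b i) j) / n)) - L"
proof -
  have "(\<Sum>i=1..n. mixture (Suc m) dict \<theta> (X i)) = (\<Sum>i=1..n. L * (1 + (\<Sum>j=1..m. \<theta> j * spin (b i) j)))"
    using b by (simp add: mixture_dict[OF \<theta>])
  also have "\<dots> = L * (n + (\<Sum>i=1..n. \<Sum>j=1..m. \<theta> j * spin (b i) j))"
    by (simp add: sum.distrib flip: sum_distrib_left)
  also have "(\<Sum>i=1..n. \<Sum>j=1..m. \<theta> j * spin (b i) j) = (\<Sum>j=1..m. \<theta> j * (\<Sum>i=1..n. spin (b i) j))"
    by (subst sum.swap) (simp add: sum_distrib_left)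
  finally have emp: "2 / n * (\<Sum>i=1..n. mixture (Suc m) dict \<theta> (X i))
    = 2 * L + L * (\<Sum>j=1..m. 2 * \<theta> j * ((\<Sum>i=1..n. spin (b i) j) / n))"
    using assms(1) by (simp add: field_simps sum_distrib_left sum_divide_distrib)
  show ?thesis
    unfolding empirical_risk_def emp l2_norm_mixture[OF \<theta>]
    by (simp add: sum_subtractf algebra_simps)
qed

text \<open>Under the sign constraint alone, each coordinate of the quadratic is minimised at the
  positive part. If these sum to at most 1, the simplex constraint does not bind.\<close>

lemma erm_eq_pos_part:
  assumes "n \<ge> 1" and b: "\<forall>i\<in>{1..n}. c (X i) = Some (b i)"
    and erm: "is_erm lborel n X (Suc m) dict \<theta>"
    and le: "(\<Sum>j=1..m. max 0 (\<Sum>i=1..n. spin (b i) j)) \<le> n"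
    and "j \<in> {1..m}"
  shows "\<theta> j = max 0 (\<Sum>i=1..n. spin (b i) j) / n"
proof -
  let ?R = "\<lambda>\<theta>. empirical_risk lborel n X (mixture (Suc m) dict \<theta>)"
  define \<xi> where "\<xi> j = (\<Sum>i=1..n. spin (b i) j) / n" for j
  define p where "p j = max 0 (\<Sum>i=1..n. spin (b i) j) / n" for j
  have p\<xi>: "p j = max 0 (\<xi> j)" for j
    by (simp add: p_def \<xi>_def max_divide_distrib_right)
  have p: "(\<Sum>j=1..m. p j) \<le> 1" "0 \<le> p j" for j
    using le assms(1) by (simp_all add: p_def flip: sum_divide_distrib)
  \<comment> \<open>The slack goes to index \<open>Suc m\<close>, the unperturbed density.\<close>
  define \<theta>' where "\<theta>' = (\<lambda>j\<in>{1..Suc m}. if j \<le> m then p j else 1 - (\<Sum>j=1..m. p j))"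
  have \<theta>: "\<theta> \<in> simplex_weights (Suc m)" using erm_simplex[OF erm] .
  then have nonneg: "0 \<le> \<theta> j" if "j \<in> {1..m}" for j
    using that by (auto simp: simplex_weights_def)
  have \<theta>': "\<theta>' \<in> simplex_weights (Suc m)"
    using p by (auto simp: simplex_weights_def \<theta>'_def)
  have \<theta>'_p: "\<theta>' j = p j" if "j \<in> {1..m}" for j using that by (simp add: \<theta>'_def)
  \<comment> \<open>Quadratic growth around the minimiser: equality if
    \<open>\<xi> j \<ge> 0\<close>; otherwise \<open>p j = 0\<close> and
    \<open>- 2 * \<theta> j * \<xi> j\<close> is nonnegative.\<close>
  have "(\<theta> j - p j)\<^sup>2 \<le> ((\<theta> j)\<^sup>2 - 2 * \<theta> j * \<xi> j) - ((p j)\<^sup>2 - 2 * p j * \<xi> j)" if "j \<in> {1..m}" for j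
    using nonneg[OF that] by (cases "\<xi> j \<ge> 0")
      (auto simp: p\<xi> max_def power2_eq_square algebra_simps mult_nonneg_nonpos)
  then have "L * (\<Sum>j=1..m. (\<theta> j - p j)\<^sup>2) \<le> ?R \<theta> - ?R \<theta>'"
    unfolding empirical_risk_cells[OF assms(1) b \<theta>] empirical_risk_cells[OF assms(1) b \<theta>'] \<xi>_def[symmetric]
    using L_pos \<theta>'_p by (simp flip: right_diff_distrib sum_subtractf) (intro sum_mono, simp)
  also have "\<dots> \<le> 0" using erm_risk_le[OF erm \<theta>'] by simp
  finally have "(\<Sum>j=1..m. (\<theta> j - p j)\<^sup>2) = 0"
    using L_pos by (intro antisym sum_nonneg) (auto simp: mult_le_0_iff)
  then show ?thesis
    using assms(5) by (subst (asm) sum_nonneg_eq_0_iff) (auto simp: p_def)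
qed

section \<open>Probability of the excess error\<close>

text \<open>The labels \<open>v i\<close> may be \<open>None\<close>, so the boxes also cover
  samples outside the support. These have probability 0 but matter for measurability.\<close>

definition cell_box :: "nat \<Rightarrow> (nat \<Rightarrow> nat set option) \<Rightarrow> (nat \<Rightarrow> real) set" where
  "cell_box n v = {X \<in> space (iid_sample lborel cell_density n). \<forall>i\<in>{1..n}. c (X i) = v i}"

lemma cell_box_eq_PiE: "cell_box n v = (\<Pi>\<^sub>E i\<in>{1..n}. c -` {v i})"
  by (simp add: cell_box_def iid_sample_def space_PiM set_eq_iff PiE_iff conj_commute)

lemma sets_cell_box: "cell_box n v \<in> sets (iid_sample lborel cell_density n)"
  unfolding cell_box_eq_PiE iid_sample_def
  by (rule sets_PiM_I_finite) (auto simp: cell_sets)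

lemma prob_space_iid_sample: "prob_space (iid_sample lborel cell_density n)"
  unfolding iid_sample_def
  using prob_density_cell_density by (intro prob_space_PiM) (simp add: prob_density_def)

lemma measure_cell_box:
  assumes "\<forall>i\<in>{1..n}. b i \<subseteq> {1..m}"
  shows "measure (iid_sample lborel cell_density n) (cell_box n (\<lambda>i. Some (b i))) = 1 / (2 ^ m) ^ n"
proof -
  let ?P = "density lborel (\<lambda>x. ennreal (cell_density x))"
  interpret P: prob_space ?P
    using prob_density_cell_density by (simp add: prob_density_def)
  interpret PP: product_prob_space "\<lambda>_. ?P" "{1..n}" ..
  have "emeasure (PiM {1..n} (\<lambda>_. ?P)) (\<Pi>\<^sub>E i\<in>{1..n}. c -` {Some (b i)}) = (\<Prod>i\<in>{1..n}. emeasure ?P (c -` {Some (b i)}))"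
    by (rule PP.emeasure_PiM) (auto simp: cell_sets)
  also have "\<dots> = ennreal (1 / (2 ^ m) ^ n)"
    using assms by (simp add: emeasure_density_cell ennreal_power power_divide)
  finally show ?thesis
    by (simp add: cell_box_eq_PiE iid_sample_def measure_def)
qed

text \<open>The cells of the sample are uniform over \<open>(2 ^ m) ^ n\<close> sequences and
  distinct sequences give disjoint boxes, so probability becomes counting.\<close>

lemma measure_Union_cell_box:
  assumes B: "B \<subseteq> {1..n} \<rightarrow>\<^sub>E Pow {1..m}"
  shows "measure (iid_sample lborel cell_density n) (\<Union>b\<in>B. cell_box n (\<lambda>i. Some (b i))) = card B / (2 ^ m) ^ n"
proof -
  interpret prob_space "iid_sample lborel cell_density n" by (rule prob_space_iid_sample)
  have "finite B" using B by (rule finite_subset) (auto intro!: finite_PiE)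
  moreover have "disjoint_family_on (\<lambda>b. cell_box n (\<lambda>i. Some (b i))) B"
    unfolding disjoint_family_on_def
  proof (intro ballI impI)
    fix b b' assume b: "b \<in> B" "b' \<in> B" "b \<noteq> b'"
    then have "\<exists>i\<in>{1..n}. b i \<noteq> b' i" using B by (meson PiE_ext subsetD)
    then show "cell_box n (\<lambda>i. Some (b i)) \<inter> cell_box n (\<lambda>i. Some (b' i)) = {}"
      by (auto simp: cell_box_def)
  qed
  ultimately have "measure (iid_sample lborel cell_density n) (\<Union>b\<in>B. cell_box n (\<lambda>i. Some (b i)))
    = (\<Sum>b\<in>B. measure (iid_sample lborel cell_density n) (cell_box n (\<lambda>i. Some (b i))))"
    using sets_cell_box by (intro finite_measure_finite_Union) auto
  also have "\<dots> = (\<Sum>b\<in>B. 1 / (2 ^ m) ^ n)"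
    using B by (intro sum.cong measure_cell_box) (auto simp: PiE_iff)
  finally show ?thesis by simp
qed

lemma erm_excess_probability:
  assumes n: "n \<ge> 1" "4 * real m \<le> sqrt n"
    and erm: "\<forall>X\<in>space (iid_sample lborel cell_density n). is_erm lborel n X (Suc m) dict (\<theta> X)"
    and r: "r \<le> L * m / (8 * n)"
  shows "1 - 2 * exp (- real m / 48) \<le> measure (iid_sample lborel cell_density n)
    {X \<in> space (iid_sample lborel cell_density n).
       r \<le> (l2_norm lborel (\<lambda>x. mixture (Suc m) dict (\<theta> X) x - cell_density x))\<^sup>2}"
    (is "_ \<le> measure ?M ?E")
proof -
  interpret prob_space ?M by (rule prob_space_iid_sample)
  have E: "X \<in> ?E \<longleftrightarrow> X \<in> space ?M \<and> r \<le> L * (\<Sum>j=1..m. (\<theta> X j)\<^sup>2)" for X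
    using l2_norm_mixture_minus[OF erm_simplex] erm by auto
  define K where "K = {1..n} \<rightarrow>\<^sub>E insert None (Some ` Pow {1..m})"
  \<comment> \<open>The error is constant on a box by \<open>erm_error_unique\<close>, so a box that
    meets the event lies inside it. There are finitely many boxes, hence the event is measurable;
    otherwise \<open>measure\<close> would return 0.\<close>
  have E_eq: "?E = (\<Union>v\<in>{v \<in> K. cell_box n v \<inter> ?E \<noteq> {}}. cell_box n v)"
  proof (intro equalityI subsetI)
    fix X assume X: "X \<in> ?E"
    define v where "v = (\<lambda>i\<in>{1..n}. c (X i))"
    have "v \<in> K" unfolding v_def K_def using c_range by (intro restrict_PiE_iff[THEN iffD2] ballI)
    moreover have "X \<in> cell_box n v" using X by (simp add: cell_box_def v_def)
    ultimately show "X \<in> (\<Union>v\<in>{v \<in> K. cell_box n v \<inter> ?E \<noteq> {}}. cell_box n v)" using X by blast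
  next
    fix X assume "X \<in> (\<Union>v\<in>{v \<in> K. cell_box n v \<inter> ?E \<noteq> {}}. cell_box n v)"
    then obtain v Y where "X \<in> cell_box n v" "Y \<in> cell_box n v" "Y \<in> ?E" by blast
    then show "X \<in> ?E"
      using erm_error_unique[of n X "\<theta> X" Y "\<theta> Y"] erm unfolding E by (simp add: cell_box_def)
  qed
  have "finite K" by (auto simp: K_def intro!: finite_PiE)
  then have sets: "?E \<in> sets ?M"
    by (subst E_eq) (intro sets.finite_UN sets_cell_box, simp)
  \<comment> \<open>On a good box the minimiser is explicit and its error is at least
    \<open>L * m / (8 * n)\<close>.\<close>
  have "cell_box n (\<lambda>i. Some (b i)) \<subseteq> ?E" if b: "b \<in> good_cells n m" for b
  proof
    fix X assume "X \<in> cell_box n (\<lambda>i. Some (b i))"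
    then have X: "X \<in> space ?M" "\<forall>i\<in>{1..n}. c (X i) = Some (b i)" by (auto simp: cell_box_def)
    let ?S = "\<lambda>j. max 0 (\<Sum>i=1..n. spin (b i) j)"
    have "(\<Sum>j=1..m. (\<theta> X j)\<^sup>2) = (\<Sum>j=1..m. (?S j / n)\<^sup>2)"
      using erm_eq_pos_part[OF n(1) X(2)] erm X(1) b by (auto simp: good_cells_def intro!: sum.cong)
    also have "\<dots> = (\<Sum>j=1..m. (?S j)\<^sup>2) / (real n)\<^sup>2"
      by (simp add: power_divide sum_divide_distrib)
    also have "\<dots> \<ge> (m * n / 8) / (real n)\<^sup>2"
      using b by (intro divide_right_mono) (auto simp: good_cells_def)
    also have "(m * n / 8) / (real n)\<^sup>2 = m / (8 * n)"
      using n(1) by (simp add: power2_eq_square)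
    finally have "L * (m / (8 * n)) \<le> L * (\<Sum>j=1..m. (\<theta> X j)\<^sup>2)"
      using L_pos by (intro mult_left_mono) auto
    then show "X \<in> ?E" using X(1) r by (subst E) auto
  qed
  then have "measure ?M (\<Union>b\<in>good_cells n m. cell_box n (\<lambda>i. Some (b i))) \<le> measure ?M ?E"
    by (intro finite_measure_mono sets) blast
  moreover have "measure ?M (\<Union>b\<in>good_cells n m. cell_box n (\<lambda>i. Some (b i))) = card (good_cells n m) / (2 ^ m) ^ n"
    by (rule measure_Union_cell_box) (auto simp: good_cells_def)
  moreover have "1 - 2 * exp (- real m / 48) \<le> card (good_cells n m) / (2 ^ m) ^ n"
    using card_good_cells[OF n] by (simp add: field_simps)
  ultimately show ?thesis by linarith
qed

end

section \<open>Construction of the cells\<close>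

text \<open>The subsets are enumerated by the numbers below \<open>2 ^ m\<close>, and
  \<open>x\<close> is labelled by the integer part of \<open>N * x\<close>. The cells then have
  length \<open>1 / N\<close> and fill the interval from 0 to \<open>1 / L\<close>.\<close>

lemma cell_map_exists:
  assumes "0 < L"
  shows "\<exists>c. cell_map L m c"
proof -
  obtain e :: "nat \<Rightarrow> nat set" where e: "bij_betw e {..<2 ^ m} (Pow {1..m})"
    using finite_same_card_bij[of "{..<2 ^ m :: nat}" "Pow {1..m}"] by (auto simp: card_Pow)
  define N :: real where "N = 2 ^ m * L"
  have N: "0 < N" using assms by (simp add: N_def)
  define g where "g k = (if 0 \<le> k \<and> k < 2 ^ m then Some (e (nat k)) else None)" for k :: int
  define c where "c x = g \<lfloor>N * x\<rfloor>" for x :: real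
  have e_range: "e (nat k) \<in> Pow {1..m}" if "0 \<le> k" "k < 2 ^ m" for k
    using e that by (auto simp: bij_betw_def nat_less_iff)
  have range: "g k \<in> insert None (Some ` Pow {1..m})" for k
    using e_range[of k] by (simp add: g_def)
  have "cell_map L m c"
  proof
    have "(\<lambda>x. \<lfloor>N * x\<rfloor>) \<in> borel \<rightarrow>\<^sub>M count_space UNIV" by measurable
    moreover have "g \<in> count_space UNIV \<rightarrow>\<^sub>M count_space (insert None (Some ` Pow {1..m}))"
      using range by auto
    ultimately show "c \<in> borel \<rightarrow>\<^sub>M count_space (insert None (Some ` Pow {1..m}))"
      unfolding c_def by (rule measurable_compose)
  next
    fix S assume "S \<subseteq> {1..m}"
    then obtain k where k: "k < 2 ^ m" "e k = S"
      using e by (auto simp: bij_betw_def image_iff) (metis Pow_iff imageE lessThan_iff)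
    have "e (nat l) = S \<longleftrightarrow> l = int k" if "0 \<le> l" "l < 2 ^ m" for l
      using bij_betw_imp_inj_on[OF e] that k by (auto simp: inj_on_eq_iff nat_less_iff)
    then have "g l = Some S \<longleftrightarrow> l = int k" for l
      using k by (auto simp: g_def)
    then have "c -` {Some S} = {x. \<lfloor>N * x\<rfloor> = int k}"
      unfolding vimage_def c_def by blast
    also have "\<dots> = {k / N..<(k + 1) / N}"
      using N by (auto simp: floor_eq_iff pos_divide_le_eq pos_less_divide_eq mult.commute)
    finally show "emeasure lborel (c -` {Some S}) = ennreal (1 / (2 ^ m * L))"
      using N by (simp add: N_def field_simps flip: diff_divide_distrib)
  qed (use assms in auto)
  then show ?thesis by blast
qed

section \<open>Choice of the dictionary size and of the constants\<close>

theorem proposition2p1: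
  "\<exists>C0 C1 C2 C3 :: real. C0 > 0 \<and> C1 > 0 \<and> C2 > 0 \<and> C3 > 0 \<and>
     (\<forall>L :: real. L > 0 \<longrightarrow> (\<forall>n :: nat. n \<ge> 1 \<longrightarrow>
       (\<exists>(f :: real \<Rightarrow> real) (M :: nat) (F :: nat \<Rightarrow> real \<Rightarrow> real).
          prob_density lborel f \<and> (\<forall>x. \<bar>f x\<bar> \<le> L) \<and>
          C0 * sqrt (real n) \<le> real M \<and> real M \<le> C1 * sqrt (real n) \<and>
          inj_on F {1..M} \<and>
          (\<forall>j\<in>{1..M}. square_integrable lborel (F j) \<and> (\<forall>x. \<bar>F j x\<bar> \<le> 2 * L)) \<and>
          (\<forall>\<theta>_erm :: (nat \<Rightarrow> real) \<Rightarrow> (nat \<Rightarrow> real).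
             (\<forall>X\<in>space (iid_sample lborel f n). is_erm lborel n X M F (\<theta>_erm X)) \<longrightarrow>
             measure (iid_sample lborel f n)
               {X \<in> space (iid_sample lborel f n).
                  (l2_norm lborel (\<lambda>x. mixture M F (\<theta>_erm X) x - f x))\<^sup>2
                    \<ge> Min ((\<lambda>j. (l2_norm lborel (\<lambda>x. F j x - f x))\<^sup>2) ` {1..M})
                       + C3 * L / sqrt (real n)}
             > 1 - 12 * exp (- C2 * real M)))))"
proof -
  have main: "\<exists>(f :: real \<Rightarrow> real) (M :: nat) (F :: nat \<Rightarrow> real \<Rightarrow> real).
          prob_density lborel f \<and> (\<forall>x. \<bar>f x\<bar> \<le> L) \<and>
          1 / 4 * sqrt (real n) \<le> real M \<and> real M \<le> 2 * sqrt (real n) \<and>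
          inj_on F {1..M} \<and>
          (\<forall>j\<in>{1..M}. square_integrable lborel (F j) \<and> (\<forall>x. \<bar>F j x\<bar> \<le> 2 * L)) \<and>
          (\<forall>\<theta>_erm :: (nat \<Rightarrow> real) \<Rightarrow> (nat \<Rightarrow> real).
             (\<forall>X\<in>space (iid_sample lborel f n). is_erm lborel n X M F (\<theta>_erm X)) \<longrightarrow>
             measure (iid_sample lborel f n)
               {X \<in> space (iid_sample lborel f n).
                  (l2_norm lborel (\<lambda>x. mixture M F (\<theta>_erm X) x - f x))\<^sup>2
                    \<ge> Min ((\<lambda>j. (l2_norm lborel (\<lambda>x. F j x - f x))\<^sup>2) ` {1..M})
                       + 1 / 64 * L / sqrt (real n)}
             > 1 - 12 * exp (- (1 / 96) * real M))"
    if L: "L > 0" and n: "n \<ge> 1" for L :: real and n :: nat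
  proof -
    \<comment> \<open>This gives \<open>4 * m \<le> sqrt n < 4 * (m + 1)\<close>; with
      \<open>M = m + 1\<close> these yield the factors 2 and 1/4.\<close>
    define m where "m = nat \<lfloor>sqrt n / 4\<rfloor>"
    have sqrt_n: "1 \<le> sqrt n" using n by simp
    then have "real m = \<lfloor>sqrt n / 4\<rfloor>" by (simp add: m_def)
    then have m: "4 * real m \<le> sqrt n" by linarith
    have "sqrt n / 4 < real m + 1"
      unfolding \<open>real m = _\<close> by (rule real_of_int_floor_add_one_gt)
    then have m': "sqrt n \<le> 4 * real (Suc m)" by simp
    have m'': "real (Suc m) \<le> 2 * sqrt n" using m sqrt_n unfolding of_nat_Suc by linarith
    obtain c where "cell_map L m c" using cell_map_exists[OF L] by blast
    then interpret cell_map L m c .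
    have "1 - 12 * exp (- (1 / 96) * real (Suc m)) < measure (iid_sample lborel cell_density n)
      {X \<in> space (iid_sample lborel cell_density n).
         Min ((\<lambda>j. (l2_norm lborel (\<lambda>x. dict j x - cell_density x))\<^sup>2) ` {1..Suc m}) + 1 / 64 * L / sqrt n
         \<le> (l2_norm lborel (\<lambda>x. mixture (Suc m) dict (\<theta> X) x - cell_density x))\<^sup>2}"
      if erm: "\<forall>X\<in>space (iid_sample lborel cell_density n). is_erm lborel n X (Suc m) dict (\<theta> X)" for \<theta>
    proof (cases "m = 0")
      \<comment> \<open>For \<open>n < 16\<close> there are no perturbations, but the claimed lower
        bound on the probability is negative.\<close>
      case True
      have "1 < 12 * exp (- (1 / 96) * real (Suc m))"
        using exp_ge_add_one_self[of "- (1 / 96) :: real"] True by simp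
      then show ?thesis by (smt (verit) measure_nonneg)
    next
      case False
      \<comment> \<open>From \<open>m \<ge> 1\<close> follows \<open>m + 1 \<le> 2 * m\<close>. This
        turns \<open>m / (8 n)\<close> into \<open>1 / (64 sqrt n)\<close>, and below it turns the
        rate \<open>m / 48\<close> into \<open>(m + 1) / 96\<close>.\<close>
      then have "sqrt n \<le> 8 * real m" using m' by simp
      then have "L * sqrt n / (64 * n) \<le> L * (8 * real m) / (64 * n)"
        using L by (intro divide_right_mono mult_left_mono) auto
      moreover have "1 / 64 * L / sqrt n = L * sqrt n / (64 * n)"
        using n by (simp add: field_simps)
      ultimately have excess: "Min ((\<lambda>j. (l2_norm lborel (\<lambda>x. dict j x - cell_density x))\<^sup>2) ` {1..Suc m})
          + 1 / 64 * L / sqrt n \<le> L * m / (8 * real n)"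
        using Min_dict_le by simp
      note erm_excess_probability[OF n m erm excess]
      moreover have "2 * exp (- real m / 48) < 12 * exp (- (1 / 96) * real (Suc m))"
      proof -
        have "exp (- real m / 48) \<le> exp (- (1 / 96) * real (Suc m))" using False by simp
        moreover have "0 < exp (- (1 / 96) * real (Suc m))" by simp
        ultimately show ?thesis by linarith
      qed
      ultimately show ?thesis by linarith
    qed
    then show ?thesis
      using prob_density_cell_density inj_on_dict square_integrable_dict abs_dict_le m' m'' L
      by (intro exI[of _ cell_density] exI[of _ "Suc m"] exI[of _ dict]) (auto simp: cell_density_def)
  qed
  show ?thesis
    by (rule exI[of _ "1 / 4"], rule exI[of _ 2], rule exI[of _ "1 / 96"], rule exI[of _ "1 / 64"])
      (use main in auto)
qed

end
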